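(* Let $(\varrho^n,\boldsymbol u^n)_{0\le n\le N}$ be a numerical solution of the finite volume scheme described in the context (in particular $\varrho^n_K>0$ for all $K\in\mathcal T$ and all $n$). For $K\in\mathcal T$ set $E^n_K=\frac12\varrho^n_K|\boldsymbol u^n_K|^2+\psi_\gamma(\varrho^n_K)$. Then for each $0\le n\le N-1$ one has the entropy inequality $$\sum_{K\in\mathcal T}|K|\,E^{n+1}_K\;\le\;\sum_{K\in\mathcal T}|K|\,E^n_K ,$$ provided that the following two conditions hold for every $K\in\mathcal T$: (1) $\eta\ge \dfrac{1}{\varrho^{n+1}_K}$; (2) $\delta t\le \dfrac{|K|\,\varrho^{n+1}_K}{2\displaystyle\sum_{\sigma\in\mathcal E(K),\,\sigma=K|L}|\sigma|\,\bigl(-F^{n+1,-}_{\sigma,K}\bigr)}$ (no restriction for those $K$ for which the denominator vanishes).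
   Context: Data. $d\in\{1,2,3\}$; $\Omega\subset\mathbb R^d$ is bounded, and its closure is a finite union of closed rectangles ($d=2$) or closed parallelepipeds ($d=3$) (intervals if $d=1$). $a>0$, $\gamma>1$, $p(\varrho)=a\varrho^\gamma$, $\psi_\gamma(\varrho)=\frac{a}{\gamma-1}\varrho^\gamma$. Mesh. $\mathcal T$ is a finite tessellation of $\Omega$ into (possibly non-uniform) closed rectangles/parallelepipeds $K$ (control volumes), $\overline\Omega=\bigcup_{K\in\mathcal T}K$; $|K|$ is the $d$-dimensional Lebesgue measure. $\mathcal E$ is the set of all edges ($d=2$)/faces ($d=3$), $|\sigma|$ the $(d-1)$-dimensional measure of $\sigma\in\mathcal E$; $\mathcal E(K)$ are the edges of $K$; $\mathcal E_{int}$ and $\mathcal E_{ext}$ are the internal edges and those lying on $\partial\Omega$. An internal edge shared by $K,L$ is written $\sigma=K|L$. $\boldsymbol\nu_{\sigma,K}$ is the unit normal to $\sigma\in\mathcal E(K)$ pointing out of $K$. $\mathcal L_{\mathcal T}(\Omega)$ (resp. $\mathcal L_{\mathcal T}(\Omega;\mathbb R^d)$) is the space of scalar (resp. vector) functions constant on each $K\in\mathcal T$; $q_K$ is the value on $K$, and $\overline q_\sigma=\frac{q_K+q_L}{2}$ for $\sigma=K|L$. Operators. For $\boldsymbol w\in\mathcal L_{\mathcal T}(\Omega;\mathbb R^d)$: $w_{\sigma,K}=\overline{\boldsymbol w}_\sigma\cdot\boldsymbol\nu_{\sigma,K}$ if $\sigma=K|L$, and $w_{\sigma,K}=0$ if $\sigma\in\mathcal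 E(K)\cap\mathcal E_{ext}$. Discrete gradient: $(\nabla_{\mathcal T}q)_K=\frac1{|K|}\sum_{\sigma\in\mathcal E(K),\,\sigma=K|L}|\sigma|\frac{q_L-q_K}{2}\boldsymbol\nu_{\sigma,K}$. Upwind divergence: $(\mathrm{div}^{up}_{\mathcal T}(q,\boldsymbol v))_K=\frac1{|K|}\sum_{\sigma\in\mathcal E(K),\,\sigma=K|L}|\sigma|\bigl(q_K(v_{\sigma,K})^++q_L(v_{\sigma,K})^-\bigr)$, also applied componentwise to vector-valued $q$. Scheme. $0=t^0<\dots<t^N=T$ with constant step $\delta t=t^{n+1}-t^n$; $\eta>0$ is a parameter. Initial data $\varrho_0\in L^\infty(\Omega)$, $\varrho_0>0$ a.e., $\boldsymbol u_0\in L^\infty(\Omega;\mathbb R^d)$; $\varrho^0_K=\frac1{|K|}\int_K\varrho_0\,dx$, $\boldsymbol u^0_K=\frac1{|K|}\int_K\boldsymbol u_0\,dx$. A numerical (discrete) solution is a family $(\varrho^n,\boldsymbol u^n)\in\mathcal L_{\mathcal T}(\Omega)\times\mathcal L_{\mathcal T}(\Omega;\mathbb R^d)$, $0\le n\le N$, with $\varrho^n>0$, such that for all $0\le n\le N-1$ and all $K\in\mathcal T$ $$\tfrac1{\delta t}(\varrho^{n+1}_K-\varrho^n_K)+(\mathrm{div}^{up}_{\mathcal T}(\varrho^{n+1},\boldsymbol v^n))_K=0,$$ $$\tfrac1{\delta t}(\varrho^{n+1}_K\boldsymbol u^{n+1}_K-\varrho^n_K\boldsymbol u^n_K)+(\mathrm{div}^{up}_{\mathcal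 T}(\varrho^{n+1}\boldsymbol u^n,\boldsymbol v^n))_K+(\nabla_{\mathcal T}p^{n+1})_K=0,$$ where $p^{n}_K=p(\varrho^{n}_K)$, $\boldsymbol v^n=\boldsymbol u^n-\delta\boldsymbol u^{n+1}$, $\delta\boldsymbol u^{n+1}_K=\eta\,\delta t\,(\nabla_{\mathcal T}p^{n+1})_K$. The signed parts of $v^n_{\sigma,K}$ are by definition $(v^n_{\sigma,K})^+=(u^n_{\sigma,K})^+-(\delta u^{n+1}_{\sigma,K})^-\ge0$ and $(v^n_{\sigma,K})^-=(u^n_{\sigma,K})^--(\delta u^{n+1}_{\sigma,K})^+\le0$, where on the right-hand sides $b^\pm=\frac{b\pm|b|}{2}$ for real $b$. Finally $F^{n+1,-}_{\sigma,K}=\varrho^{n+1}_L(v^n_{\sigma,K})^-\le 0$ for $\sigma=K|L$. *)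

theory Defs
  imports "HOL-Analysis.Analysis"
begin

section \<open>Domain and mesh\<close>

definition parallelepiped :: "'a::euclidean_space set \<Rightarrow> bool" where
  "parallelepiped K \<longleftrightarrow>
     (\<exists>c. \<exists>f :: 'a \<Rightarrow> 'a. linear f \<and> inj f \<and> K = (\<lambda>x. c + f x) ` cbox 0 One)"

definition rectangle :: "'a::euclidean_space set \<Rightarrow> bool" where
  "rectangle K \<longleftrightarrow>
     (\<exists>c. \<exists>f :: 'a \<Rightarrow> 'a. linear f \<and> inj f \<and> (\<forall>i\<in>Basis. \<forall>j\<in>Basis. i \<noteq> j \<longrightarrow> f i \<bullet> f j = 0)
        \<and> K = (\<lambda>x. c + f x) ` cbox 0 One)"

text \<open>Closed intervals in dimension 1, closed rectangles in dimension 2, closed parallelepipeds in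
  dimension 3; all nondegenerate, and not required to be parallel to the axes.\<close>

definition control_volume :: "'a::euclidean_space set \<Rightarrow> bool" where
  "control_volume K \<longleftrightarrow> (if DIM('a) = 2 then rectangle K else parallelepiped K)"

definition admissible_domain :: "'a::euclidean_space set \<Rightarrow> bool" where
  "admissible_domain \<Omega> \<longleftrightarrow>
     bounded \<Omega> \<and> (\<exists>R. finite R \<and> (\<forall>K\<in>R. control_volume K) \<and> closure \<Omega> = \<Union>R)"

definition mesh_faces :: "'a::euclidean_space set set \<Rightarrow> 'a set set" where
  "mesh_faces \<T> = {\<sigma>. \<exists>K\<in>\<T>. \<sigma> facet_of K}"

definition ext_faces :: "'a::euclidean_space set \<Rightarrow> 'a set set \<Rightarrow> 'a set set" where
  "ext_faces \<Omega> \<T> = {\<sigma> \<in> mesh_faces \<T>. \<sigma> \<subseteq> frontier \<Omega>}"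

definition int_faces :: "'a::euclidean_space set \<Rightarrow> 'a set set \<Rightarrow> 'a set set" where
  "int_faces \<Omega> \<T> = mesh_faces \<T> - ext_faces \<Omega> \<T>"

text \<open>The last condition says that every face not lying on the boundary is a full face of two
  distinct control volumes (no hanging nodes).\<close>

definition tessellation :: "'a::euclidean_space set \<Rightarrow> 'a set set \<Rightarrow> bool" where
  "tessellation \<Omega> \<T> \<longleftrightarrow>
     finite \<T> \<and> (\<forall>K\<in>\<T>. control_volume K) \<and> closure \<Omega> = \<Union>\<T> \<and>
     (\<forall>K\<in>\<T>. \<forall>L\<in>\<T>. K \<noteq> L \<longrightarrow> interior K \<inter> interior L = {}) \<and>
     (\<forall>\<sigma>\<in>int_faces \<Omega> \<T>. \<exists>K\<in>\<T>. \<exists>L\<in>\<T>. K \<noteq> L \<and> \<sigma> facet_of K \<and> \<sigma> facet_of L)"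

text \<open>The faces \<open>\<sigma>\<close> of \<open>K\<close> that are of the form \<open>\<sigma> = K|L\<close>, and the cell \<open>L\<close> in question.\<close>

definition int_faces_of :: "'a::euclidean_space set \<Rightarrow> 'a set set \<Rightarrow> 'a set \<Rightarrow> 'a set set" where
  "int_faces_of \<Omega> \<T> K = {\<sigma> \<in> int_faces \<Omega> \<T>. \<sigma> facet_of K}"

definition neighbour :: "'a::euclidean_space set set \<Rightarrow> 'a set \<Rightarrow> 'a set \<Rightarrow> 'a set" where
  "neighbour \<T> \<sigma> K = (THE L. L \<in> \<T> \<and> L \<noteq> K \<and> \<sigma> facet_of L)"

definition unit_normal_to :: "'a::euclidean_space set \<Rightarrow> 'a \<Rightarrow> bool" where
  "unit_normal_to \<sigma> n \<longleftrightarrow> norm n = 1 \<and> (\<forall>x\<in>\<sigma>. \<forall>y\<in>\<sigma>. n \<bullet> (y - x) = 0)"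

definition outer_normal :: "'a::euclidean_space set \<Rightarrow> 'a set \<Rightarrow> 'a" where
  "outer_normal \<sigma> K = (THE n. unit_normal_to \<sigma> n \<and> (\<forall>x\<in>\<sigma>. \<forall>y\<in>K. n \<bullet> (y - x) \<le> 0))"

definition vol :: "'a::euclidean_space set \<Rightarrow> real" where
  "vol K = measure lebesgue K"

text \<open>The \<open>(d-1)\<close>-dimensional measure of a subset \<open>\<sigma>\<close> of a hyperplane, obtained as the
  \<open>d\<close>-dimensional measure of the right prism of height 1 over \<open>\<sigma>\<close>. The two unit normals of a face
  give prisms that are translates of each other, so the choice is immaterial. In dimension 1
  the measure of a point is 1.\<close>

definition face_measure :: "'a::euclidean_space set \<Rightarrow> real" where
  "face_measure \<sigma> =
     (let n = (SOME n. unit_normal_to \<sigma> n)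
      in measure lebesgue {x + s *\<^sub>R n | x s. x \<in> \<sigma> \<and> 0 \<le> s \<and> s \<le> 1})"


section \<open>Discrete operators\<close>

text \<open>A function that is constant on each control volume is represented by its values
  \<open>K \<mapsto> q\<^sub>K\<close>; only the values at \<open>K \<in> \<T>\<close> are ever used.\<close>

definition pos_part :: "real \<Rightarrow> real" where
  "pos_part b = (b + \<bar>b\<bar>) / 2"

definition neg_part :: "real \<Rightarrow> real" where
  "neg_part b = (b - \<bar>b\<bar>) / 2"

text \<open>The normal component \<open>w\<^sub>\<sigma>\<^sub>,\<^sub>K\<close> of a vector-valued discrete function on a face \<open>\<sigma>\<close> of \<open>K\<close>.\<close>

definition face_comp ::
  "'a::euclidean_space set \<Rightarrow> 'a set set \<Rightarrow> ('a set \<Rightarrow> 'a) \<Rightarrow> 'a set \<Rightarrow> 'a set \<Rightarrow> real" where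
  "face_comp \<Omega> \<T> w \<sigma> K =
     (if \<sigma> \<in> int_faces \<Omega> \<T>
      then ((1/2) *\<^sub>R (w K + w (neighbour \<T> \<sigma> K))) \<bullet> outer_normal \<sigma> K
      else 0)"

definition disc_grad ::
  "'a::euclidean_space set \<Rightarrow> 'a set set \<Rightarrow> ('a set \<Rightarrow> real) \<Rightarrow> 'a set \<Rightarrow> 'a" where
  "disc_grad \<Omega> \<T> q K =
     (1 / vol K) *\<^sub>R
       (\<Sum>\<sigma>\<in>int_faces_of \<Omega> \<T> K.
          (face_measure \<sigma> * ((q (neighbour \<T> \<sigma> K) - q K) / 2)) *\<^sub>R outer_normal \<sigma> K)"

text \<open>The signed parts of \<open>v\<^sub>\<sigma>\<^sub>,\<^sub>K\<close> for \<open>v = u - w\<close>, where \<open>w\<close> is the velocity correction. They are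
  defined from \<open>u\<close> and \<open>w\<close> separately; in general they are not the positive and negative parts of the
  real number \<open>v\<^sub>\<sigma>\<^sub>,\<^sub>K\<close>, although their sum is \<open>v\<^sub>\<sigma>\<^sub>,\<^sub>K\<close>.\<close>

definition vel_pos ::
  "'a::euclidean_space set \<Rightarrow> 'a set set \<Rightarrow> ('a set \<Rightarrow> 'a) \<Rightarrow> ('a set \<Rightarrow> 'a) \<Rightarrow> 'a set \<Rightarrow> 'a set \<Rightarrow> real"
  where
  "vel_pos \<Omega> \<T> u w \<sigma> K =
     pos_part (face_comp \<Omega> \<T> u \<sigma> K) - neg_part (face_comp \<Omega> \<T> w \<sigma> K)"

definition vel_neg ::
  "'a::euclidean_space set \<Rightarrow> 'a set set \<Rightarrow> ('a set \<Rightarrow> 'a) \<Rightarrow> ('a set \<Rightarrow> 'a) \<Rightarrow> 'a set \<Rightarrow> 'a set \<Rightarrow> real"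
  where
  "vel_neg \<Omega> \<T> u w \<sigma> K =
     neg_part (face_comp \<Omega> \<T> u \<sigma> K) - pos_part (face_comp \<Omega> \<T> w \<sigma> K)"

text \<open>The upwind divergence of \<open>q\<close> with respect to \<open>v = u - w\<close>. It is used for scalar \<open>q\<close> and, as the
  formula is linear in \<open>q\<close>, for vector-valued \<open>q\<close>, where it acts componentwise.\<close>

definition upwind_div ::
  "'a::euclidean_space set \<Rightarrow> 'a set set \<Rightarrow> ('a set \<Rightarrow> 'b::real_vector) \<Rightarrow>
     ('a set \<Rightarrow> 'a) \<Rightarrow> ('a set \<Rightarrow> 'a) \<Rightarrow> 'a set \<Rightarrow> 'b" where
  "upwind_div \<Omega> \<T> q u w K =
     (1 / vol K) *\<^sub>R
       (\<Sum>\<sigma>\<in>int_faces_of \<Omega> \<T> K.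
          face_measure \<sigma> *\<^sub>R
            (vel_pos \<Omega> \<T> u w \<sigma> K *\<^sub>R q K + vel_neg \<Omega> \<T> u w \<sigma> K *\<^sub>R q (neighbour \<T> \<sigma> K)))"


section \<open>The scheme\<close>

definition pressure :: "real \<Rightarrow> real \<Rightarrow> real \<Rightarrow> real" where
  "pressure a \<gamma> r = a * r powr \<gamma>"

definition psi :: "real \<Rightarrow> real \<Rightarrow> real \<Rightarrow> real" where
  "psi a \<gamma> r = a / (\<gamma> - 1) * r powr \<gamma>"

definition vel_correction ::
  "'a::euclidean_space set \<Rightarrow> 'a set set \<Rightarrow> real \<Rightarrow> real \<Rightarrow> real \<Rightarrow> real \<Rightarrow>
     ('a set \<Rightarrow> real) \<Rightarrow> 'a set \<Rightarrow> 'a" where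
  "vel_correction \<Omega> \<T> a \<gamma> \<eta> dt r K =
     (\<eta> * dt) *\<^sub>R disc_grad \<Omega> \<T> (\<lambda>L. pressure a \<gamma> (r L)) K"

definition time_grid :: "real \<Rightarrow> nat \<Rightarrow> real \<Rightarrow> (nat \<Rightarrow> real) \<Rightarrow> bool" where
  "time_grid T N dt t \<longleftrightarrow>
     t 0 = 0 \<and> t N = T \<and> (\<forall>n<N. t n < t (Suc n) \<and> t (Suc n) - t n = dt)"

definition ess_bounded_on ::
  "'a::euclidean_space set \<Rightarrow> ('a \<Rightarrow> 'b::euclidean_space) \<Rightarrow> bool" where
  "ess_bounded_on \<Omega> f \<longleftrightarrow>
     \<Omega> \<in> sets lebesgue \<and> f \<in> borel_measurable (lebesgue_on \<Omega>) \<and>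
     (\<exists>C. AE x in lebesgue_on \<Omega>. norm (f x) \<le> C)"

text \<open>The data are functions on \<open>\<Omega>\<close>, whereas \<open>K\<close> is only contained in the closure of \<open>\<Omega>\<close>; hence the
  integral runs over \<open>K \<inter> \<Omega>\<close>.\<close>

definition cell_average ::
  "'a::euclidean_space set \<Rightarrow> ('a \<Rightarrow> 'b::euclidean_space) \<Rightarrow> 'a set \<Rightarrow> 'b" where
  "cell_average \<Omega> f K = (1 / vol K) *\<^sub>R set_lebesgue_integral lebesgue (K \<inter> \<Omega>) f"

definition mass_update ::
  "'a::euclidean_space set \<Rightarrow> 'a set set \<Rightarrow> real \<Rightarrow> real \<Rightarrow> real \<Rightarrow> real \<Rightarrow>
     (nat \<Rightarrow> 'a set \<Rightarrow> real) \<Rightarrow> (nat \<Rightarrow> 'a set \<Rightarrow> 'a) \<Rightarrow> nat \<Rightarrow> 'a set \<Rightarrow> bool" where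
  "mass_update \<Omega> \<T> a \<gamma> \<eta> dt \<rho> u n K \<longleftrightarrow>
     (1 / dt) * (\<rho> (Suc n) K - \<rho> n K)
     + upwind_div \<Omega> \<T> (\<rho> (Suc n)) (u n) (vel_correction \<Omega> \<T> a \<gamma> \<eta> dt (\<rho> (Suc n))) K = 0"

definition momentum_update ::
  "'a::euclidean_space set \<Rightarrow> 'a set set \<Rightarrow> real \<Rightarrow> real \<Rightarrow> real \<Rightarrow> real \<Rightarrow>
     (nat \<Rightarrow> 'a set \<Rightarrow> real) \<Rightarrow> (nat \<Rightarrow> 'a set \<Rightarrow> 'a) \<Rightarrow> nat \<Rightarrow> 'a set \<Rightarrow> bool" where
  "momentum_update \<Omega> \<T> a \<gamma> \<eta> dt \<rho> u n K \<longleftrightarrow>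
     (1 / dt) *\<^sub>R (\<rho> (Suc n) K *\<^sub>R u (Suc n) K - \<rho> n K *\<^sub>R u n K)
     + upwind_div \<Omega> \<T> (\<lambda>L. \<rho> (Suc n) L *\<^sub>R u n L) (u n)
         (vel_correction \<Omega> \<T> a \<gamma> \<eta> dt (\<rho> (Suc n))) K
     + disc_grad \<Omega> \<T> (\<lambda>L. pressure a \<gamma> (\<rho> (Suc n) L)) K = 0"

definition numerical_solution ::
  "'a::euclidean_space set \<Rightarrow> 'a set set \<Rightarrow> real \<Rightarrow> real \<Rightarrow> real \<Rightarrow> real \<Rightarrow> nat \<Rightarrow>
     ('a \<Rightarrow> real) \<Rightarrow> ('a \<Rightarrow> 'a) \<Rightarrow> (nat \<Rightarrow> 'a set \<Rightarrow> real) \<Rightarrow> (nat \<Rightarrow> 'a set \<Rightarrow> 'a) \<Rightarrow> bool" where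
  "numerical_solution \<Omega> \<T> a \<gamma> \<eta> dt N \<rho>0 u0 \<rho> u \<longleftrightarrow>
     (\<forall>K\<in>\<T>. \<rho> 0 K = cell_average \<Omega> \<rho>0 K \<and> u 0 K = cell_average \<Omega> u0 K) \<and>
     (\<forall>n\<le>N. \<forall>K\<in>\<T>. \<rho> n K > 0) \<and>
     (\<forall>n<N. \<forall>K\<in>\<T>. mass_update \<Omega> \<T> a \<gamma> \<eta> dt \<rho> u n K \<and> momentum_update \<Omega> \<T> a \<gamma> \<eta> dt \<rho> u n K)"

definition flux_neg ::
  "'a::euclidean_space set \<Rightarrow> 'a set set \<Rightarrow> real \<Rightarrow> real \<Rightarrow> real \<Rightarrow> real \<Rightarrow>
     (nat \<Rightarrow> 'a set \<Rightarrow> real) \<Rightarrow> (nat \<Rightarrow> 'a set \<Rightarrow> 'a) \<Rightarrow> nat \<Rightarrow> 'a set \<Rightarrow> 'a set \<Rightarrow> real" where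
  "flux_neg \<Omega> \<T> a \<gamma> \<eta> dt \<rho> u n \<sigma> K =
     \<rho> (Suc n) (neighbour \<T> \<sigma> K)
     * vel_neg \<Omega> \<T> (u n) (vel_correction \<Omega> \<T> a \<gamma> \<eta> dt (\<rho> (Suc n))) \<sigma> K"

definition cell_energy ::
  "real \<Rightarrow> real \<Rightarrow> (nat \<Rightarrow> 'a::euclidean_space set \<Rightarrow> real) \<Rightarrow> (nat \<Rightarrow> 'a set \<Rightarrow> 'a) \<Rightarrow>
     nat \<Rightarrow> 'a set \<Rightarrow> real" where
  "cell_energy a \<gamma> \<rho> u n K = 1/2 * \<rho> n K * (norm (u n K))\<^sup>2 + psi a \<gamma> (\<rho> n K)"

end

theory Submission
  imports Defs
begin

text \<open>
  Multiplying the momentum equation by \<open>u\<^sup>n\<close> and using the mass equation gives the kinetic energy balance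
  of a cell, with a numerical dissipation term \<open>1/2 (-F\<^sup>-) |u\<^sub>L - u\<^sub>K|\<^sup>2\<close> and the explicit-in-time error
  \<open>|K| \<rho> |u\<^sup>n\<^sup>+\<^sup>1 - u\<^sup>n|\<^sup>2 / (2 \<delta>t)\<close>. The momentum equation bounds this error by the squares of the upwind
  jumps, which the condition on \<open>\<delta>t\<close> absorbs into the dissipation, and of the pressure gradient, which the
  condition on \<open>\<eta>\<close> absorbs into the work of the velocity correction \<open>\<eta> \<delta>t \<nabla>p\<close>. What is left is the work
  \<open>- \<nabla>p \<bullet> v\<close> of the stabilised velocity. Since \<open>p = \<rho> \<psi>' - \<psi>\<close>, convexity of \<open>\<psi>\<close> and the upwind mass
  equation show that the increase of internal energy is at most \<open>\<nabla>p \<bullet> v\<close>. Fluxes cancel in the sum over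
  all cells because an inner face has exactly two cells, with opposite outer normals.
\<close>

section \<open>Faces of control volumes\<close>

lemma control_volume_polytope:
  assumes "control_volume K"
  shows "polytope K" and "interior K \<noteq> {}"
proof -
  obtain c and f :: "'a \<Rightarrow> 'a" where f: "linear f" "inj f"
    and K: "K = (\<lambda>x. c + f x) ` cbox 0 One"
    using assms by (auto simp: control_volume_def rectangle_def parallelepiped_def split: if_splits)
  have K': "K = (+) c ` f ` cbox 0 One"
    by (simp add: K image_image)
  show "polytope K"
    unfolding K' polytope_translation_eq by (intro polytope_linear_image f polytope_interval)
  have "interior (cbox 0 (One :: 'a)) \<noteq> {}"
    by (simp add: box_ne_empty)
  then show "interior K \<noteq> {}"
    unfolding K' by (simp add: interior_translation interior_injective_linear_image f)
qed

lemma vol_pos: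
  assumes "polytope K" and "interior K \<noteq> {}"
  shows "vol K > 0"
proof -
  have "K \<in> lmeasurable"
    using assms(1) by (simp add: lmeasurable_compact polytope_imp_compact)
  moreover have "\<not> negligible K"
    using open_not_negligible[OF open_interior assms(2)] negligible_subset[OF _ interior_subset] by auto
  ultimately show ?thesis
    unfolding vol_def zero_less_measure_iff by (simp add: negligible_iff_measure)
qed

text \<open>A supporting hyperplane cuts out the facet, and rescaling makes its normal a unit
  vector. As \<open>K\<close> has interior points, the facet has the dimension of the hyperplane, so
  its affine hull is all of it. This is what fixes the normal up to sign.\<close>

lemma facet_hyperplane:
  fixes K :: "'a::euclidean_space set"
  assumes "polytope K" and "interior K \<noteq> {}" and "\<sigma> facet_of K"
  obtains n b where "norm n = 1" and "K \<subseteq> {x. n \<bullet> x \<le> b}"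
    and "\<sigma> = K \<inter> {x. n \<bullet> x = b}" and "affine hull \<sigma> = {x. n \<bullet> x = b}"
proof -
  obtain a c where a: "a \<noteq> 0" "K \<subseteq> {x. a \<bullet> x \<le> c}" "\<sigma> = K \<inter> {x. a \<bullet> x = c}"
    using facet_of_polyhedron[OF polytope_imp_polyhedron] assms by metis
  define n b where "n = (1 / norm a) *\<^sub>R a" and "b = c / norm a"
  have eqs: "n \<bullet> x \<le> b \<longleftrightarrow> a \<bullet> x \<le> c" "n \<bullet> x = b \<longleftrightarrow> a \<bullet> x = c" for x
    using a(1) by (auto simp: n_def b_def divide_simps)
  have "affine hull \<sigma> = {x. a \<bullet> x = c}"
  proof (rule affine_dim_equal)
    show "affine hull \<sigma> \<noteq> {}"
      using assms(3) by (auto simp: facet_of_def)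
    show "affine hull \<sigma> \<subseteq> {x. a \<bullet> x = c}"
      using a(3) by (intro hull_minimal affine_hyperplane) auto
    show "aff_dim (affine hull \<sigma>) = aff_dim {x. a \<bullet> x = c}"
      using assms a(1) by (simp add: facet_of_def aff_dim_hyperplane aff_dim_nonempty_interior)
  qed (auto simp: affine_hyperplane)
  then show ?thesis
    using a by (intro that[of n b]) (simp_all add: eqs, simp add: n_def)
qed

text \<open>The functional \<open>m\<close> is constant on \<open>\<sigma>\<close>, hence on the
  whole hyperplane. The part of \<open>m\<close> orthogonal to \<open>n\<close> is a direction of
  that hyperplane, so \<open>m\<close> annihilates it, and it must vanish.\<close>

lemma unit_normal_to_cases:
  fixes n m :: "'a::euclidean_space"
  assumes "norm n = 1" and "affine hull \<sigma> = {x. n \<bullet> x = b}" and "unit_normal_to \<sigma> m"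
  shows "m = n \<or> m = - n"
proof -
  \<comment> \<open>For a unit vector \<open>n\<close> this is a point of the hyperplane, so the
    hull, and with it \<open>\<sigma>\<close>, is nonempty.\<close>
  have "b *\<^sub>R n \<in> affine hull \<sigma>"
    using assms(1,2) by (simp add: norm_eq_1)
  then have "\<sigma> \<noteq> {}"
    by auto
  then obtain x where x: "x \<in> \<sigma>" by blast
  have "affine hull \<sigma> \<subseteq> {y. m \<bullet> y = m \<bullet> x}"
  proof (intro hull_minimal affine_hyperplane subsetI CollectI)
    fix y assume "y \<in> \<sigma>"
    then have "m \<bullet> (y - x) = 0"
      using assms(3) x unfolding unit_normal_to_def by blast
    then show "m \<bullet> y = m \<bullet> x"
      by (simp add: inner_diff_right)
  qed
  then have hyp: "n \<bullet> y = b \<Longrightarrow> m \<bullet> y = m \<bullet> x" for y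
    using assms(2) by blast
  have nx: "n \<bullet> x = b"
    using x assms(2) hull_inc by fastforce
  define y where "y = m - (m \<bullet> n) *\<^sub>R n"
  have nn: "n \<bullet> n = 1" and mm: "m \<bullet> m = 1"
    using assms by (auto simp: norm_eq_1 unit_normal_to_def)
  have ny: "n \<bullet> y = 0"
    by (simp add: y_def inner_diff_right nn inner_commute)
  then have "m \<bullet> y = 0"
    using hyp[of "x + y"] nx by (simp add: inner_add_right)
  then have "y \<bullet> y = 0"
    using ny by (simp add: y_def inner_diff_left)
  then have m: "m = (m \<bullet> n) *\<^sub>R n"
    by (simp add: y_def)
  then have "(m \<bullet> n)\<^sup>2 = 1"
    using mm by (metis inner_commute inner_scaleR_right power2_eq_square)
  then show ?thesis
    using m by (metis power2_eq_1_iff scaleR_minus1_left scaleR_one)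
qed

text \<open>Resolves the definite description: only \<open>n\<close> and \<open>- n\<close> are
  candidates, and a point of \<open>K\<close> strictly below the hyperplane, available because
  \<open>K\<close> has interior points, rules out \<open>- n\<close>.\<close>

lemma outer_normal_eq:
  fixes K :: "'a::euclidean_space set"
  assumes "interior K \<noteq> {}" and "norm n = 1" and "K \<subseteq> {x. n \<bullet> x \<le> b}"
    and "\<sigma> = K \<inter> {x. n \<bullet> x = b}" and hull: "affine hull \<sigma> = {x. n \<bullet> x = b}"
  shows "outer_normal \<sigma> K = n"
proof -
  have un: "unit_normal_to \<sigma> n"
    using assms by (auto simp: unit_normal_to_def inner_diff_right)
  have "\<not> K \<subseteq> {x. n \<bullet> x = b}"
  proof
    assume "K \<subseteq> {x. n \<bullet> x = b}"
    then have "interior K \<subseteq> interior {x. n \<bullet> x = b}"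
      by (rule interior_mono)
    moreover have "n \<noteq> 0"
      using assms(2) by auto
    ultimately show False
      using assms(1) by simp
  qed
  then obtain y where y: "y \<in> K" "n \<bullet> y < b"
    using assms(3) by fastforce
  have "b *\<^sub>R n \<in> affine hull \<sigma>"
    using assms(2) hull by (simp add: norm_eq_1)
  then have "\<sigma> \<noteq> {}"
    by auto
  then obtain x where x: "x \<in> \<sigma>" by blast
  show ?thesis
    unfolding outer_normal_def
  proof (rule the_equality)
    show "unit_normal_to \<sigma> n \<and> (\<forall>x\<in>\<sigma>. \<forall>y\<in>K. n \<bullet> (y - x) \<le> 0)"
      using un assms by (auto simp: inner_diff_right)
  next
    fix m assume m: "unit_normal_to \<sigma> m \<and> (\<forall>x\<in>\<sigma>. \<forall>y\<in>K. m \<bullet> (y - x) \<le> 0)"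
    then have "m \<bullet> (y - x) \<le> 0"
      using x y by blast
    moreover have "n \<bullet> (y - x) < 0"
      using x y assms(4) by (auto simp: inner_diff_right)
    ultimately have "m \<noteq> - n"
      by auto
    then show "m = n"
      using unit_normal_to_cases[OF assms(2) hull] m by blast
  qed
qed

text \<open>Both normals belong to the same hyperplane, so they are equal or opposite. Equal normals
  would put both cells on one side of the common face and make their interiors meet.\<close>

lemma outer_normal_opposite:
  fixes K L :: "'a::euclidean_space set"
  assumes K: "polytope K" "interior K \<noteq> {}" "\<sigma> facet_of K"
    and L: "polytope L" "interior L \<noteq> {}" "\<sigma> facet_of L"
    and disj: "interior K \<inter> interior L = {}"
  shows "outer_normal \<sigma> L = - outer_normal \<sigma> K" and "norm (outer_normal \<sigma> K) = 1"
proof -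
  obtain n b where n: "norm n = 1" "K \<subseteq> {x. n \<bullet> x \<le> b}" "\<sigma> = K \<inter> {x. n \<bullet> x = b}"
    "affine hull \<sigma> = {x. n \<bullet> x = b}"
    using facet_hyperplane[OF K] .
  obtain m c where m: "norm m = 1" "L \<subseteq> {x. m \<bullet> x \<le> c}" "\<sigma> = L \<inter> {x. m \<bullet> x = c}"
    "affine hull \<sigma> = {x. m \<bullet> x = c}"
    using facet_hyperplane[OF L] .
  have onK: "outer_normal \<sigma> K = n" and onL: "outer_normal \<sigma> L = m"
    using outer_normal_eq n m K(2) L(2) by blast+
  then show "norm (outer_normal \<sigma> K) = 1"
    using n by simp
  have "unit_normal_to \<sigma> m"
    using m by (auto simp: unit_normal_to_def inner_diff_right)
  then have "m = n \<or> m = - n"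
    using unit_normal_to_cases n by blast
  moreover have "m \<noteq> n"
  proof
    assume "m = n"
    \<comment> \<open>Then \<open>K\<close> and \<open>L\<close> lie on the same side of the face. Moving slightly from a relative interior
      point \<open>x\<close> of \<open>\<sigma>\<close> towards an interior point \<open>y\<close> of \<open>K\<close> one stays inside the hull of \<open>\<sigma>\<close> and an
      interior point \<open>z\<close> of \<open>L\<close>: \<open>k\<close> is the ratio of the heights of \<open>y\<close> and \<open>z\<close>, and \<open>x + q s\<close> is the
      projection from \<open>z\<close> of \<open>x + s (y - x)\<close> onto the hyperplane of \<open>\<sigma>\<close>.\<close>
    have convex: "convex K" "convex L" "convex \<sigma>" and closed: "closed L"
      using K L by (auto simp: polytope_imp_convex polytope_imp_closed facet_of_def
          intro: face_of_imp_convex)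
    have "\<sigma> \<noteq> {}"
      using K(3) by (simp add: facet_of_def)
    then obtain x where x: "x \<in> rel_interior \<sigma>"
      using convex rel_interior_eq_empty by blast
    then obtain e where e: "e > 0" "ball x e \<inter> affine hull \<sigma> \<subseteq> \<sigma>" and "x \<in> \<sigma>"
      using mem_rel_interior_ball by blast
    have "c = b"
      using \<open>x \<in> \<sigma>\<close> n m \<open>m = n\<close> by auto
    have below: "\<exists>y\<in>interior A. n \<bullet> y < b"
      if "A \<subseteq> {x. n \<bullet> x \<le> b}" "interior A \<noteq> {}" for A
    proof -
      have "interior A \<subseteq> interior {x. n \<bullet> x \<le> b}"
        using that by (intro interior_mono)
      moreover have "n \<noteq> 0"
        using n(1) by auto
      ultimately show ?thesis
        using that(2) by (auto simp: interior_halfspace_le)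
    qed
    obtain y where y: "y \<in> interior K" "n \<bullet> y < b"
      using below n(2) K(2) by blast
    obtain z where z: "z \<in> interior L" "n \<bullet> z < b"
      using below m(2) L(2) \<open>m = n\<close> \<open>c = b\<close> by blast
    define k where "k = (b - n \<bullet> y) / (b - n \<bullet> z)"
    define q where "q s = (s / (1 - s * k)) *\<^sub>R ((y - x) - k *\<^sub>R (z - x))" for s
    have nx: "n \<bullet> x = b"
      using \<open>x \<in> \<sigma>\<close> n(3) by auto
    have "k * (n \<bullet> z - b) = n \<bullet> y - b"
      using z by (simp add: k_def divide_simps) (simp add: algebra_simps)
    then have nq: "n \<bullet> q s = 0" for s
      using nx by (simp add: q_def inner_diff_right)
    have k: "k > 0"
      using y z by (simp add: k_def)
    \<comment> \<open>For small \<open>s\<close> the point \<open>x + q s\<close> stays where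
      \<open>\<sigma>\<close> fills its affine hull. The further conditions on \<open>s\<close> make
      \<open>s\<close> and \<open>s * k\<close> admissible weights of convex combinations.\<close>
    have "(q \<longlongrightarrow> 0) (at_right 0)"
      unfolding q_def by (auto intro!: tendsto_eq_intros)
    then have ev1: "\<forall>\<^sub>F s in at_right 0. dist (q s) 0 < e"
      using e(1) by (rule tendstoD)
    have "((\<lambda>s. s * k) \<longlongrightarrow> 0) (at_right 0)"
      by (auto intro!: tendsto_eq_intros)
    then have ev2: "\<forall>\<^sub>F s in at_right 0. s * k < 1"
      by (rule order_tendstoD) simp
    have ev3: "\<forall>\<^sub>F s in at_right 0. s < (1::real)"
      by (rule eventually_at_rightI[of 0 1]) auto
    have ev4: "\<forall>\<^sub>F s in at_right 0. (0::real) < s"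
      by (rule eventually_at_right_less)
    obtain s where s: "dist (q s) 0 < e" "s * k < 1" "s < 1" "0 < s"
      using eventually_happens[OF eventually_conj[OF ev1 eventually_conj[OF ev2 eventually_conj[OF ev3 ev4]]]]
      by auto
    define w where "w = x + s *\<^sub>R (y - x)"
    have "x + q s \<in> \<sigma>"
      using e(2) s(1) nx nq n(4) by (auto simp: subset_iff dist_norm inner_add_right)
    then have "x + q s \<in> L"
      using m(3) by auto
    moreover have "z \<in> L"
      using z interior_subset by blast
    moreover have "w = (1 - s * k) *\<^sub>R (x + q s) + (s * k) *\<^sub>R z"
    proof -
      have "(1 - s * k) *\<^sub>R q s = s *\<^sub>R ((y - x) - k *\<^sub>R (z - x))"
        using s(2) by (simp add: q_def)
      then show ?thesis
        by (simp add: w_def scaleR_add_right) (simp add: algebra_simps)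
    qed
    ultimately have wL: "w \<in> L"
      using convex(2) s k by (simp add: convexD)
    have "x \<in> K"
      using \<open>x \<in> \<sigma>\<close> n(3) by auto
    then have "w \<in> interior K"
      using mem_interior_convex_shrink[OF convex(1) y(1) _ s(4)] s(3)
      by (simp add: w_def algebra_simps)
    \<comment> \<open>The point \<open>w\<close> may lie on the boundary of \<open>L\<close>, but
      \<open>L\<close> is the closure of its interior, and an open set that meets a closure meets
      the set itself.\<close>
    then have "interior K \<inter> closure (interior L) \<noteq> {}"
      using wL convex_closure_interior[OF convex(2) L(2)] closed by auto
    then show False
      using disj open_Int_closure_eq_empty[of "interior K" "interior L"] by auto
  qed
  ultimately show "outer_normal \<sigma> L = - outer_normal \<sigma> K"
    using onK onL by auto
qed

section \<open>Neighbouring cells across an inner face\<close>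

lemma tessellation_cell:
  assumes "tessellation \<Omega> \<T>" and "K \<in> \<T>"
  shows "polytope K" and "interior K \<noteq> {}" and "vol K > 0" and "finite (int_faces_of \<Omega> \<T> K)"
proof -
  have "control_volume K"
    using assms by (auto simp: tessellation_def)
  then show *: "polytope K" "interior K \<noteq> {}"
    by (rule control_volume_polytope)+
  then show "vol K > 0"
    by (rule vol_pos)
  show "finite (int_faces_of \<Omega> \<T> K)"
    by (rule finite_subset[OF _ finite_polytope_facets[OF *(1)]]) (auto simp: int_faces_of_def)
qed

lemma adjacent_cells_normal:
  assumes "tessellation \<Omega> \<T>" and "K \<in> \<T>" and "L \<in> \<T>" and "K \<noteq> L"
    and "\<sigma> facet_of K" and "\<sigma> facet_of L"
  shows "outer_normal \<sigma> L = - outer_normal \<sigma> K" and "norm (outer_normal \<sigma> K) = 1"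
proof -
  have "interior K \<inter> interior L = {}"
    using assms by (auto simp: tessellation_def)
  then show "outer_normal \<sigma> L = - outer_normal \<sigma> K" "norm (outer_normal \<sigma> K) = 1"
    using outer_normal_opposite[of K \<sigma> L] tessellation_cell[OF assms(1)] assms by blast+
qed

lemma neighbour_eq:
  assumes "tessellation \<Omega> \<T>" and "K \<in> \<T>" and "L \<in> \<T>" and "K \<noteq> L"
    and "\<sigma> facet_of K" and "\<sigma> facet_of L"
  shows "neighbour \<T> \<sigma> K = L"
  unfolding neighbour_def
proof (rule the_equality)
  show "L \<in> \<T> \<and> L \<noteq> K \<and> \<sigma> facet_of L"
    using assms by auto
next
  fix M assume M: "M \<in> \<T> \<and> M \<noteq> K \<and> \<sigma> facet_of M"
  show "M = L"
  proof (rule ccontr)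
    assume "M \<noteq> L"
    \<comment> \<open>Three cells sharing a face would have three pairwise opposite unit normals.\<close>
    then have "outer_normal \<sigma> M = - outer_normal \<sigma> L"
      using adjacent_cells_normal(1)[of \<Omega> \<T> L M \<sigma>] assms M by auto
    moreover have "outer_normal \<sigma> M = - outer_normal \<sigma> K"
      using adjacent_cells_normal(1)[of \<Omega> \<T> K M \<sigma>] assms M by auto
    moreover have "outer_normal \<sigma> L = - outer_normal \<sigma> K" "norm (outer_normal \<sigma> K) = 1"
      using adjacent_cells_normal assms by blast+
    ultimately have "(2::real) *\<^sub>R outer_normal \<sigma> K = 0"
      by (metis add.inverse_inverse add.right_inverse scaleR_2)
    then show False
      using \<open>norm (outer_normal \<sigma> K) = 1\<close> by auto
  qed
qed

lemma int_face_neighbour: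
  assumes "tessellation \<Omega> \<T>" and "K \<in> \<T>" and "\<sigma> \<in> int_faces_of \<Omega> \<T> K"
  shows "neighbour \<T> \<sigma> K \<in> \<T>" and "\<sigma> \<in> int_faces_of \<Omega> \<T> (neighbour \<T> \<sigma> K)"
    and "neighbour \<T> \<sigma> (neighbour \<T> \<sigma> K) = K"
    and "outer_normal \<sigma> (neighbour \<T> \<sigma> K) = - outer_normal \<sigma> K"
proof -
  have \<sigma>: "\<sigma> \<in> int_faces \<Omega> \<T>" "\<sigma> facet_of K"
    using assms(3) by (auto simp: int_faces_of_def)
  have "\<forall>\<sigma>\<in>int_faces \<Omega> \<T>. \<exists>A\<in>\<T>. \<exists>B\<in>\<T>. A \<noteq> B \<and> \<sigma> facet_of A \<and> \<sigma> facet_of B"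
    using assms(1) by (simp add: tessellation_def)
  then obtain A B where "A \<in> \<T>" "B \<in> \<T>" "A \<noteq> B" "\<sigma> facet_of A" "\<sigma> facet_of B"
    using \<sigma>(1) by meson
  \<comment> \<open>At least one of the distinct cells \<open>A\<close> and \<open>B\<close> differs
    from \<open>K\<close>.\<close>
  then obtain L where L: "L \<in> \<T>" "K \<noteq> L" "\<sigma> facet_of L"
    by metis
  have nb: "neighbour \<T> \<sigma> K = L" "neighbour \<T> \<sigma> L = K"
    using neighbour_eq[OF assms(1)] assms(2) L \<sigma> by auto
  show "neighbour \<T> \<sigma> K \<in> \<T>" "\<sigma> \<in> int_faces_of \<Omega> \<T> (neighbour \<T> \<sigma> K)"
    "neighbour \<T> \<sigma> (neighbour \<T> \<sigma> K) = K"
    using nb L \<sigma> by (auto simp: int_faces_of_def)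
  show "outer_normal \<sigma> (neighbour \<T> \<sigma> K) = - outer_normal \<sigma> K"
    using adjacent_cells_normal(1)[OF assms(1,2) L(1,2) \<sigma>(2) L(3)] nb by simp
qed

text \<open>Crossing the face is an involution on the pairs of a cell and one of its inner faces, so
  it may be used to reindex the sum.\<close>

lemma sum_int_faces_swap:
  fixes f :: "'a::euclidean_space set \<Rightarrow> 'a set \<Rightarrow> 'a set \<Rightarrow> 'b::comm_monoid_add"
  assumes "tessellation \<Omega> \<T>"
  shows "(\<Sum>K\<in>\<T>. \<Sum>\<sigma>\<in>int_faces_of \<Omega> \<T> K. f K (neighbour \<T> \<sigma> K) \<sigma>) =
         (\<Sum>K\<in>\<T>. \<Sum>\<sigma>\<in>int_faces_of \<Omega> \<T> K. f (neighbour \<T> \<sigma> K) K \<sigma>)"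
proof -
  have fin: "finite \<T>"
    using assms by (simp add: tessellation_def)
  let ?S = "Sigma \<T> (int_faces_of \<Omega> \<T>)"
  let ?h = "\<lambda>(K, \<sigma>). (neighbour \<T> \<sigma> K, \<sigma>)"
  have "(\<Sum>(K, \<sigma>)\<in>?S. f K (neighbour \<T> \<sigma> K) \<sigma>) = (\<Sum>(K, \<sigma>)\<in>?S. f (neighbour \<T> \<sigma> K) K \<sigma>)"
    by (rule sum.reindex_bij_witness[of _ ?h ?h]) (auto simp: int_face_neighbour[OF assms])
  then show ?thesis
    using tessellation_cell(4)[OF assms] by (simp add: sum.Sigma[OF fin])
qed

section \<open>Summation over faces\<close>

lemma face_measure_nonneg: "face_measure \<sigma> \<ge> 0"
  by (simp add: face_measure_def Let_def)

lemma vel_neg_nonpos: "vel_neg \<Omega> \<T> u w \<sigma> K \<le> 0"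
  by (simp add: vel_neg_def pos_part_def neg_part_def)

lemma vel_pos_add_neg:
  "vel_pos \<Omega> \<T> u w \<sigma> K + vel_neg \<Omega> \<T> u w \<sigma> K
     = face_comp \<Omega> \<T> u \<sigma> K - face_comp \<Omega> \<T> w \<sigma> K"
  by (simp add: vel_pos_def vel_neg_def pos_part_def neg_part_def field_simps)

lemma face_comp_neighbour:
  assumes "tessellation \<Omega> \<T>" and "K \<in> \<T>" and "\<sigma> \<in> int_faces_of \<Omega> \<T> K"
  shows "face_comp \<Omega> \<T> w \<sigma> (neighbour \<T> \<sigma> K) = - face_comp \<Omega> \<T> w \<sigma> K"
  using int_face_neighbour[OF assms] by (simp add: face_comp_def add.commute)

text \<open>This is conservativity of the upwind flux. It survives the unusual signed parts because
  \<open>u\<close> and \<open>w\<close> enter separately and each face component changes sign across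
  the face.\<close>

lemma vel_pos_neighbour:
  assumes "tessellation \<Omega> \<T>" and "K \<in> \<T>" and "\<sigma> \<in> int_faces_of \<Omega> \<T> K"
  shows "vel_pos \<Omega> \<T> u w \<sigma> (neighbour \<T> \<sigma> K) = - vel_neg \<Omega> \<T> u w \<sigma> K"
  by (simp add: vel_pos_def vel_neg_def face_comp_neighbour[OF assms] pos_part_def neg_part_def field_simps)

text \<open>Outflow terms are moved to the cell across the face, where they become inflow terms;
  only the nonpositive coefficients \<open>vel_neg\<close> remain. \<open>Y\<close> takes both cells
  so that it can also express non-conservative products. If \<open>Y K L = X L\<close>, the sum
  vanishes.\<close>

lemma upwind_flux_sum:
  fixes \<T> :: "'a::euclidean_space set set" and X :: "'a set \<Rightarrow> real"
  assumes "tessellation \<Omega> \<T>"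
  shows "(\<Sum>K\<in>\<T>. \<Sum>\<sigma>\<in>int_faces_of \<Omega> \<T> K. face_measure \<sigma> *
            (vel_pos \<Omega> \<T> u w \<sigma> K * X K + vel_neg \<Omega> \<T> u w \<sigma> K * Y K (neighbour \<T> \<sigma> K)))
       = (\<Sum>K\<in>\<T>. \<Sum>\<sigma>\<in>int_faces_of \<Omega> \<T> K. face_measure \<sigma> * vel_neg \<Omega> \<T> u w \<sigma> K *
            (Y K (neighbour \<T> \<sigma> K) - X (neighbour \<T> \<sigma> K)))"
proof -
  have "(\<Sum>K\<in>\<T>. \<Sum>\<sigma>\<in>int_faces_of \<Omega> \<T> K. face_measure \<sigma> * vel_pos \<Omega> \<T> u w \<sigma> K * X K)
      = (\<Sum>K\<in>\<T>. \<Sum>\<sigma>\<in>int_faces_of \<Omega> \<T> K.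
           face_measure \<sigma> * vel_pos \<Omega> \<T> u w \<sigma> (neighbour \<T> \<sigma> K) * X (neighbour \<T> \<sigma> K))"
    by (rule sum_int_faces_swap[OF assms])
  also have "\<dots> = (\<Sum>K\<in>\<T>. \<Sum>\<sigma>\<in>int_faces_of \<Omega> \<T> K.
           - (face_measure \<sigma> * vel_neg \<Omega> \<T> u w \<sigma> K * X (neighbour \<T> \<sigma> K)))"
    by (intro sum.cong refl) (simp add: vel_pos_neighbour[OF assms])
  finally show ?thesis
    by (simp add: algebra_simps sum.distrib sum_subtractf sum_negf)
qed

text \<open>Discrete integration by parts. Exchanging the two cells in the neighbour terms and using
  opposite normals joins the values of \<open>z\<close> on both sides into their mean on the
  face.\<close>

lemma disc_grad_duality:
  assumes "tessellation \<Omega> \<T>"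
  shows "(\<Sum>K\<in>\<T>. vol K * (disc_grad \<Omega> \<T> q K \<bullet> z K))
       = - (\<Sum>K\<in>\<T>. \<Sum>\<sigma>\<in>int_faces_of \<Omega> \<T> K. face_measure \<sigma> * (q K * face_comp \<Omega> \<T> z \<sigma> K))"
proof -
  have "(\<Sum>K\<in>\<T>. vol K * (disc_grad \<Omega> \<T> q K \<bullet> z K))
      = (\<Sum>K\<in>\<T>. \<Sum>\<sigma>\<in>int_faces_of \<Omega> \<T> K. face_measure \<sigma> / 2 * q (neighbour \<T> \<sigma> K) * (outer_normal \<sigma> K \<bullet> z K))
      - (\<Sum>K\<in>\<T>. \<Sum>\<sigma>\<in>int_faces_of \<Omega> \<T> K. face_measure \<sigma> / 2 * q K * (outer_normal \<sigma> K \<bullet> z K))"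
    unfolding sum_subtractf[symmetric]
  proof (intro sum.cong refl)
    fix K assume "K \<in> \<T>"
    then have "vol K > 0"
      using tessellation_cell(3)[OF assms] by blast
    then show "vol K * (disc_grad \<Omega> \<T> q K \<bullet> z K)
      = (\<Sum>\<sigma>\<in>int_faces_of \<Omega> \<T> K. face_measure \<sigma> / 2 * q (neighbour \<T> \<sigma> K) * (outer_normal \<sigma> K \<bullet> z K)
          - face_measure \<sigma> / 2 * q K * (outer_normal \<sigma> K \<bullet> z K))"
      by (simp add: disc_grad_def inner_sum_left) (intro sum.cong refl; simp add: field_simps)
  qed
  also have "(\<Sum>K\<in>\<T>. \<Sum>\<sigma>\<in>int_faces_of \<Omega> \<T> K. face_measure \<sigma> / 2 * q (neighbour \<T> \<sigma> K) * (outer_normal \<sigma> K \<bullet> z K))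
      = (\<Sum>K\<in>\<T>. \<Sum>\<sigma>\<in>int_faces_of \<Omega> \<T> K. face_measure \<sigma> / 2 * q K *
           (outer_normal \<sigma> (neighbour \<T> \<sigma> K) \<bullet> z (neighbour \<T> \<sigma> K)))"
    by (rule sum_int_faces_swap[OF assms])
  also have "\<dots> - (\<Sum>K\<in>\<T>. \<Sum>\<sigma>\<in>int_faces_of \<Omega> \<T> K. face_measure \<sigma> / 2 * q K * (outer_normal \<sigma> K \<bullet> z K))
      = - (\<Sum>K\<in>\<T>. \<Sum>\<sigma>\<in>int_faces_of \<Omega> \<T> K. face_measure \<sigma> * (q K * face_comp \<Omega> \<T> z \<sigma> K))"
    unfolding sum_subtractf[symmetric] sum_negf[symmetric]
    by (intro sum.cong refl)
      (auto simp: face_comp_def int_face_neighbour[OF assms] int_faces_of_def inner_add_left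
        inner_add_right inner_commute field_simps)
  finally show ?thesis .
qed

section \<open>Energy balance in one control volume\<close>

text \<open>Cauchy-Schwarz, with each weight split into two square roots.\<close>

lemma norm_sum_weighted_le:
  fixes x :: "'i \<Rightarrow> 'v::real_inner"
  assumes "\<And>i. i \<in> I \<Longrightarrow> c i \<ge> 0"
  shows "(norm (\<Sum>i\<in>I. c i *\<^sub>R x i))\<^sup>2 \<le> (\<Sum>i\<in>I. c i) * (\<Sum>i\<in>I. c i * (norm (x i))\<^sup>2)"
proof -
  have "norm (\<Sum>i\<in>I. c i *\<^sub>R x i) \<le> (\<Sum>i\<in>I. sqrt (c i) * (sqrt (c i) * norm (x i)))"
    using assms by (intro order_trans[OF norm_sum] sum_mono) (simp flip: mult.assoc)
  then have "(norm (\<Sum>i\<in>I. c i *\<^sub>R x i))\<^sup>2 \<le> (\<Sum>i\<in>I. sqrt (c i) * (sqrt (c i) * norm (x i)))\<^sup>2"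
    by (rule power_mono) simp
  also have "\<dots> \<le> (\<Sum>i\<in>I. (sqrt (c i))\<^sup>2) * (\<Sum>i\<in>I. (sqrt (c i) * norm (x i))\<^sup>2)"
    by (rule Cauchy_Schwarz_ineq_sum)
  also have "\<dots> = (\<Sum>i\<in>I. c i) * (\<Sum>i\<in>I. c i * (norm (x i))\<^sup>2)"
    using assms by (simp add: power_mult_distrib)
  finally show ?thesis .
qed

text \<open>The estimate is local, so the geometry is reduced to numbers: \<open>k\<close> is the
  cell volume, \<open>r\<close>, \<open>u\<close> and \<open>\<rho>\<close>, \<open>U\<close> are
  old and new density and velocity, \<open>Fp\<close> and \<open>Fm\<close> the mass fluxes times
  face measure, \<open>x i\<close> the old velocity across face \<open>i\<close>, and
  \<open>g\<close> the pressure gradient.\<close>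

lemma kinetic_energy_cell:
  fixes U u g :: "'v::real_inner" and x :: "'i \<Rightarrow> 'v"
  assumes pos: "k > 0" "dt > 0" "\<rho> > 0" and neg: "\<And>i. i \<in> I \<Longrightarrow> Fm i \<le> 0"
    and mass: "k * (\<rho> - r) = - dt * (\<Sum>i\<in>I. Fp i + Fm i)"
    and mom: "k *\<^sub>R (\<rho> *\<^sub>R U - r *\<^sub>R u) = - dt *\<^sub>R ((\<Sum>i\<in>I. Fp i *\<^sub>R u + Fm i *\<^sub>R x i) + k *\<^sub>R g)"
    and \<eta>: "1 \<le> \<eta> * \<rho>"
    and cfl: "2 * dt * (\<Sum>i\<in>I. - Fm i) \<le> k * \<rho>"
  shows "k * (1/2 * \<rho> * (norm U)\<^sup>2 - 1/2 * r * (norm u)\<^sup>2)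
     \<le> dt * (k * (g \<bullet> ((\<eta> * dt) *\<^sub>R g - u))
         - 1/2 * (\<Sum>i\<in>I. Fp i * (norm u)\<^sup>2 + Fm i * (norm (x i))\<^sup>2))"
proof -
  define S where "S = (\<Sum>i\<in>I. - Fm i)"
  define P where "P = (\<Sum>i\<in>I. Fp i)"
  define D where "D = (\<Sum>i\<in>I. (- Fm i) *\<^sub>R (x i - u))"
  define Q where "Q = (\<Sum>i\<in>I. - Fm i * (norm (x i - u))\<^sup>2)"
  define R where "R = (\<Sum>i\<in>I. - Fm i * (norm (x i))\<^sup>2)"
  have Q: "Q = R - 2 * (u \<bullet> D) - S * (norm u)\<^sup>2"
    by (simp add: Q_def R_def D_def S_def inner_sum_right sum_distrib_left sum_distrib_right
        sum_subtractf[symmetric] power2_norm_eq_inner inner_diff_left inner_diff_right inner_commute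
        algebra_simps)
  have Q0: "Q \<ge> 0" and S0: "S \<ge> 0"
    using neg by (auto simp: Q_def S_def mult_nonpos_nonneg intro!: sum_nonneg)
  have mass': "k * (\<rho> - r) = - dt * (P - S)"
    by (simp add: mass P_def S_def sum.distrib sum_negf)
  \<comment> \<open>Subtracting \<open>u\<close> times the mass equation from the momentum equation
    leaves only inflow jumps.\<close>
  have mom': "(k * \<rho>) *\<^sub>R (U - u) = dt *\<^sub>R (D - k *\<^sub>R g)"
  proof -
    have D: "(\<Sum>i\<in>I. Fp i *\<^sub>R u + Fm i *\<^sub>R x i) = (P - S) *\<^sub>R u - D"
      by (simp add: D_def P_def S_def sum.distrib sum_subtractf sum_negf scaleR_sum_left algebra_simps)
    have "(k * \<rho>) *\<^sub>R (U - u) = k *\<^sub>R (\<rho> *\<^sub>R U - r *\<^sub>R u) - (k * (\<rho> - r)) *\<^sub>R u"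
      by (simp add: algebra_simps)
    also have "\<dots> = dt *\<^sub>R (D - k *\<^sub>R g)"
      unfolding mom mass' D by (simp add: algebra_simps)
    finally show ?thesis .
  qed
  have kr: "k * \<rho> > 0"
    using pos by simp
  have inn: "k * \<rho> * (u \<bullet> (U - u)) = dt * (u \<bullet> D - k * (u \<bullet> g))"
    using arg_cong[OF mom', of "\<lambda>v. u \<bullet> v"] by (simp add: inner_diff_right)
  have "(norm (D - k *\<^sub>R g))\<^sup>2 \<le> 2 * (norm D)\<^sup>2 + 2 * (k * norm g)\<^sup>2"
  proof -
    have "norm (D - k *\<^sub>R g) \<le> norm D + k * norm g"
      using norm_triangle_ineq4[of D "k *\<^sub>R g"] pos by simp
    then have "(norm (D - k *\<^sub>R g))\<^sup>2 \<le> (norm D + k * norm g)\<^sup>2"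
      by (rule power_mono) simp
    also have "\<dots> \<le> 2 * (norm D)\<^sup>2 + 2 * (k * norm g)\<^sup>2"
      using sum_squares_bound[of "norm D" "k * norm g"] by (simp add: power2_sum)
    finally show ?thesis .
  qed
  moreover have "(norm D)\<^sup>2 \<le> S * Q"
    unfolding D_def S_def Q_def using neg by (intro norm_sum_weighted_le) simp
  ultimately have nD: "(norm (D - k *\<^sub>R g))\<^sup>2 \<le> 2 * (S * Q) + 2 * (k * norm g)\<^sup>2"
    by linarith
  \<comment> \<open>The time step restriction absorbs the velocity jumps, the lower bound on \<open>\<eta>\<close> the pressure
    gradient.\<close>
  have jump: "k * \<rho> * (norm (U - u))\<^sup>2 \<le> dt * Q + 2 * \<eta> * dt\<^sup>2 * k * (norm g)\<^sup>2"
  proof -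
    have "(k * \<rho>)\<^sup>2 * (norm (U - u))\<^sup>2 = dt\<^sup>2 * (norm (D - k *\<^sub>R g))\<^sup>2"
      using arg_cong[OF mom', of "\<lambda>v. (norm v)\<^sup>2"] by (simp add: power_mult_distrib)
    also have "\<dots> \<le> dt\<^sup>2 * (2 * (S * Q) + 2 * (k * norm g)\<^sup>2)"
      using nD by (intro mult_left_mono) auto
    \<comment> \<open>Grouped so that the two hypotheses enlarge the leading factors
      \<open>2 * dt * S\<close> and 1; then \<open>k * \<rho>\<close> can be cancelled.\<close>
    also have "\<dots> = (2 * dt * S) * (dt * Q) + 1 * (2 * dt\<^sup>2 * k\<^sup>2 * (norm g)\<^sup>2)"
      by (simp add: algebra_simps power2_eq_square)
    also have "\<dots> \<le> (k * \<rho>) * (dt * Q) + (\<eta> * \<rho>) * (2 * dt\<^sup>2 * k\<^sup>2 * (norm g)\<^sup>2)"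
      using cfl \<eta> Q0 pos by (intro add_mono mult_right_mono) (auto simp: S_def)
    also have "\<dots> = (k * \<rho>) * (dt * Q + 2 * \<eta> * dt\<^sup>2 * k * (norm g)\<^sup>2)"
      by (simp add: algebra_simps power2_eq_square)
    finally have "(k * \<rho>) * (k * \<rho> * (norm (U - u))\<^sup>2)
        \<le> (k * \<rho>) * (dt * Q + 2 * \<eta> * dt\<^sup>2 * k * (norm g)\<^sup>2)"
      by (simp add: power2_eq_square mult.assoc)
    then show ?thesis
      using kr by (rule mult_left_le_imp_le)
  qed
  have U: "(norm U)\<^sup>2 = (norm u)\<^sup>2 + 2 * (u \<bullet> (U - u)) + (norm (U - u))\<^sup>2"
    by (simp add: power2_norm_eq_inner inner_diff_left inner_diff_right inner_commute)
  have "k * (1/2 * \<rho> * (norm U)\<^sup>2 - 1/2 * r * (norm u)\<^sup>2)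
      = 1/2 * (k * (\<rho> - r)) * (norm u)\<^sup>2 + k * \<rho> * (u \<bullet> (U - u)) + 1/2 * (k * \<rho> * (norm (U - u))\<^sup>2)"
    unfolding U by (simp add: algebra_simps)
  also have "\<dots> \<le> - 1/2 * dt * (P - S) * (norm u)\<^sup>2 + dt * (u \<bullet> D - k * (u \<bullet> g))
      + 1/2 * (dt * Q + 2 * \<eta> * dt\<^sup>2 * k * (norm g)\<^sup>2)"
    unfolding inn mass' using jump by simp
  \<comment> \<open>Expanding \<open>Q\<close> cancels the cross term \<open>u \<bullet> D\<close>
    and the terms with \<open>S\<close>, leaving the kinetic energy flux.\<close>
  also have "\<dots> = dt * (k * (g \<bullet> ((\<eta> * dt) *\<^sub>R g - u)) - 1/2 * (P * (norm u)\<^sup>2 - R))"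
    unfolding Q
    by (simp add: inner_diff_right dot_square_norm inner_commute[of g u] power2_eq_square[of dt] field_simps)
  also have "P * (norm u)\<^sup>2 - R = (\<Sum>i\<in>I. Fp i * (norm u)\<^sup>2 + Fm i * (norm (x i))\<^sup>2)"
    by (simp add: P_def R_def sum.distrib sum_distrib_right sum_negf)
  finally show ?thesis .
qed

section \<open>Convexity of the internal energy\<close>

definition psi_deriv :: "real \<Rightarrow> real \<Rightarrow> real \<Rightarrow> real" where
  "psi_deriv a \<gamma> r = a / (\<gamma> - 1) * (\<gamma> * r powr (\<gamma> - 1))"

lemma psi_above_tangent:
  assumes "a > 0" and "\<gamma> > 1" and "x > 0" and "y > 0"
  shows "psi a \<gamma> y \<ge> psi a \<gamma> x + psi_deriv a \<gamma> x * (y - x)"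
proof -
  have "y powr \<gamma> - x powr \<gamma> \<ge> \<gamma> * x powr (\<gamma> - 1) * (y - x)"
    using assms
    by (intro convex_on_imp_above_tangent[where A = "{0<..}"] powr_convex)
      (auto intro!: derivative_eq_intros simp: interior_open)
  then have "a / (\<gamma> - 1) * (\<gamma> * x powr (\<gamma> - 1) * (y - x)) \<le> a / (\<gamma> - 1) * (y powr \<gamma> - x powr \<gamma>)"
    using assms by (intro mult_left_mono) auto
  then show ?thesis
    by (simp add: psi_def psi_deriv_def right_diff_distrib mult.assoc)
qed

text \<open>The pressure is the Legendre transform of \<open>psi\<close> at its slope; the
  coefficients combine as \<open>\<gamma> / (\<gamma> - 1) - 1 / (\<gamma> - 1) = 1\<close>.\<close>

lemma pressure_eq_legendre:
  assumes "\<gamma> > 1" and "r > 0"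
  shows "pressure a \<gamma> r = r * psi_deriv a \<gamma> r - psi a \<gamma> r"
proof -
  have "r * r powr (\<gamma> - 1) = r powr \<gamma>"
    using assms powr_mult_base[of r "\<gamma> - 1"] by simp
  then have "r * psi_deriv a \<gamma> r = a / (\<gamma> - 1) * \<gamma> * r powr \<gamma>"
    by (simp add: psi_deriv_def)
  then show ?thesis
    using assms by (simp add: pressure_def psi_def field_simps)
qed

section \<open>The entropy inequality\<close>

theorem theorem1p14:
  fixes \<Omega> :: "'a::euclidean_space set" and \<T> :: "'a set set"
    and a \<gamma> \<eta> dt T :: real and N n :: nat and t :: "nat \<Rightarrow> real"
    and \<rho>0 :: "'a \<Rightarrow> real" and u0 :: "'a \<Rightarrow> 'a"
    and \<rho> :: "nat \<Rightarrow> 'a set \<Rightarrow> real" and u :: "nat \<Rightarrow> 'a set \<Rightarrow> 'a"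
  assumes "DIM('a) \<in> {1, 2, 3}"
    and "admissible_domain \<Omega>" and "tessellation \<Omega> \<T>"
    and "a > 0" and "\<gamma> > 1" and "\<eta> > 0"
    and "time_grid T N dt t"
    and "ess_bounded_on \<Omega> \<rho>0" and "AE x in lebesgue_on \<Omega>. \<rho>0 x > 0" and "ess_bounded_on \<Omega> u0"
    and "numerical_solution \<Omega> \<T> a \<gamma> \<eta> dt N \<rho>0 u0 \<rho> u"
    and "n < N"
    and "\<And>K. K \<in> \<T> \<Longrightarrow> \<eta> \<ge> 1 / \<rho> (Suc n) K"
    and "\<And>K. K \<in> \<T> \<Longrightarrow>
           (\<Sum>\<sigma>\<in>int_faces_of \<Omega> \<T> K. face_measure \<sigma> * (- flux_neg \<Omega> \<T> a \<gamma> \<eta> dt \<rho> u n \<sigma> K)) \<noteq> 0 \<Longrightarrow>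
           dt \<le> vol K * \<rho> (Suc n) K /
             (2 * (\<Sum>\<sigma>\<in>int_faces_of \<Omega> \<T> K. face_measure \<sigma> * (- flux_neg \<Omega> \<T> a \<gamma> \<eta> dt \<rho> u n \<sigma> K)))"
  shows "(\<Sum>K\<in>\<T>. vol K * cell_energy a \<gamma> \<rho> u (Suc n) K) \<le> (\<Sum>K\<in>\<T>. vol K * cell_energy a \<gamma> \<rho> u n K)"
proof -
  note tess = \<open>tessellation \<Omega> \<T>\<close>
  have dt: "dt > 0"
    using \<open>time_grid T N dt t\<close> \<open>n < N\<close> by (force simp: time_grid_def)
  define r where "r = \<rho> (Suc n)"
  define q where "q K = pressure a \<gamma> (r K)" for K
  define g where "g = disc_grad \<Omega> \<T> q"
  define w where "w = vel_correction \<Omega> \<T> a \<gamma> \<eta> dt r"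
  define m where "m \<sigma> = face_measure \<sigma>" for \<sigma> :: "'a set"
  define vp vm where "vp = vel_pos \<Omega> \<T> (u n) w" and "vm = vel_neg \<Omega> \<T> (u n) w"
  define nb where "nb = neighbour \<T>"
  define E where "E = int_faces_of \<Omega> \<T>"
  \<comment> \<open>The negative of the stabilised velocity.\<close>
  define z where "z K = w K - u n K" for K
  have w: "w K = (\<eta> * dt) *\<^sub>R g K" for K
    by (simp add: w_def g_def q_def[abs_def] vel_correction_def)
  have m0: "m \<sigma> \<ge> 0" for \<sigma>
    by (simp add: m_def face_measure_nonneg)
  have vm0: "vm \<sigma> K \<le> 0" for \<sigma> K
    by (simp add: vm_def vel_neg_nonpos)
  have r0: "r K > 0" and \<rho>0: "\<rho> n K > 0" if "K \<in> \<T>" for K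
    using \<open>numerical_solution \<Omega> \<T> a \<gamma> \<eta> dt N \<rho>0 u0 \<rho> u\<close> \<open>n < N\<close> that
    by (auto simp: numerical_solution_def r_def)
  have nbT: "nb \<sigma> K \<in> \<T>" if "K \<in> \<T>" "\<sigma> \<in> E K" for K \<sigma>
    using int_face_neighbour(1)[OF tess] that by (simp add: nb_def E_def)
  have vol: "vol K > 0" if "K \<in> \<T>" for K
    using tessellation_cell(3)[OF tess that] .
  have flux: "(\<Sum>K\<in>\<T>. \<Sum>\<sigma>\<in>E K. m \<sigma> * (vp \<sigma> K * X K + vm \<sigma> K * Y K (nb \<sigma> K)))
      = (\<Sum>K\<in>\<T>. \<Sum>\<sigma>\<in>E K. m \<sigma> * vm \<sigma> K * (Y K (nb \<sigma> K) - X (nb \<sigma> K)))" for X Y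
    unfolding E_def m_def vp_def vm_def nb_def by (rule upwind_flux_sum[OF tess])
  have mass: "vol K * (r K - \<rho> n K)
      = - dt * (\<Sum>\<sigma>\<in>E K. m \<sigma> * (vp \<sigma> K * r K) + m \<sigma> * (vm \<sigma> K * r (nb \<sigma> K)))"
    if "K \<in> \<T>" for K
  proof -
    let ?S = "\<Sum>\<sigma>\<in>E K. m \<sigma> * (vp \<sigma> K * r K) + m \<sigma> * (vm \<sigma> K * r (nb \<sigma> K))"
    have "mass_update \<Omega> \<T> a \<gamma> \<eta> dt \<rho> u n K"
      using \<open>numerical_solution \<Omega> \<T> a \<gamma> \<eta> dt N \<rho>0 u0 \<rho> u\<close> \<open>n < N\<close> that
      by (simp add: numerical_solution_def)
    then have "(1 / dt) * (r K - \<rho> n K) + (1 / vol K) * ?S = 0"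
      by (simp add: mass_update_def upwind_div_def r_def w_def vp_def vm_def m_def nb_def E_def
          distrib_left)
    then show ?thesis
      using dt vol[OF that] by (simp add: field_simps)
  qed
  have mom: "vol K *\<^sub>R (r K *\<^sub>R u (Suc n) K - \<rho> n K *\<^sub>R u n K)
      = - dt *\<^sub>R ((\<Sum>\<sigma>\<in>E K. (m \<sigma> * (vp \<sigma> K * r K)) *\<^sub>R u n K
            + (m \<sigma> * (vm \<sigma> K * r (nb \<sigma> K))) *\<^sub>R u n (nb \<sigma> K)) + vol K *\<^sub>R g K)"
    if "K \<in> \<T>" for K
  proof -
    let ?S = "\<Sum>\<sigma>\<in>E K. (m \<sigma> * (vp \<sigma> K * r K)) *\<^sub>R u n K
            + (m \<sigma> * (vm \<sigma> K * r (nb \<sigma> K))) *\<^sub>R u n (nb \<sigma> K)"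
    let ?d = "r K *\<^sub>R u (Suc n) K - \<rho> n K *\<^sub>R u n K"
    have "momentum_update \<Omega> \<T> a \<gamma> \<eta> dt \<rho> u n K"
      using \<open>numerical_solution \<Omega> \<T> a \<gamma> \<eta> dt N \<rho>0 u0 \<rho> u\<close> \<open>n < N\<close> that
      by (simp add: numerical_solution_def)
    then have eq: "(1 / dt) *\<^sub>R ?d + (1 / vol K) *\<^sub>R ?S + g K = 0"
      by (simp add: momentum_update_def upwind_div_def r_def w_def vp_def vm_def m_def nb_def E_def
          g_def q_def[abs_def] scaleR_add_right)
    have "vol K *\<^sub>R ?d + dt *\<^sub>R (?S + vol K *\<^sub>R g K)
        = (vol K * dt) *\<^sub>R ((1 / dt) *\<^sub>R ?d + (1 / vol K) *\<^sub>R ?S + g K)"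
      using dt vol[OF that] by (simp add: scaleR_add_right)
    then have "vol K *\<^sub>R ?d + dt *\<^sub>R (?S + vol K *\<^sub>R g K) = 0"
      unfolding eq by simp
    then show ?thesis
      by (simp add: eq_neg_iff_add_eq_0)
  qed
  have cfl: "2 * dt * (\<Sum>\<sigma>\<in>E K. - (m \<sigma> * (vm \<sigma> K * r (nb \<sigma> K)))) \<le> vol K * r K"
    if K: "K \<in> \<T>" for K
  proof -
    let ?S = "\<Sum>\<sigma>\<in>E K. - (m \<sigma> * (vm \<sigma> K * r (nb \<sigma> K)))"
    have S: "(\<Sum>\<sigma>\<in>int_faces_of \<Omega> \<T> K.
        face_measure \<sigma> * (- flux_neg \<Omega> \<T> a \<gamma> \<eta> dt \<rho> u n \<sigma> K)) = ?S"
      by (simp add: flux_neg_def E_def m_def vm_def w_def r_def nb_def mult.commute)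
    have "?S \<ge> 0"
      using m0 vm0 r0 nbT K
      by (intro sum_nonneg) (simp add: mult_nonneg_nonpos mult_nonpos_nonneg less_imp_le)
    show ?thesis
    proof (cases "?S = 0")
      \<comment> \<open>The time step is unrestricted here, but the left side is zero.\<close>
      case True
      then show ?thesis
        using vol[OF K] r0[OF K] by simp
    next
      case False
      then have "?S > 0"
        using \<open>?S \<ge> 0\<close> by simp
      moreover have "dt \<le> vol K * r K / (2 * ?S)"
        using assms(14)[OF K] False unfolding S r_def by simp
      ultimately show ?thesis
        by (simp add: pos_le_divide_eq mult.commute mult.left_commute)
    qed
  qed
  have \<eta>: "1 \<le> \<eta> * r K" if "K \<in> \<T>" for K
    using assms(13)[OF that] r0[OF that] by (simp add: r_def field_simps)
  have kin: "vol K * (1/2 * r K * (norm (u (Suc n) K))\<^sup>2 - 1/2 * \<rho> n K * (norm (u n K))\<^sup>2)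
      \<le> dt * (vol K * (g K \<bullet> z K) - 1/2 * (\<Sum>\<sigma>\<in>E K. m \<sigma> * (vp \<sigma> K * (r K * (norm (u n K))\<^sup>2)
            + vm \<sigma> K * (r (nb \<sigma> K) * (norm (u n (nb \<sigma> K)))\<^sup>2))))"
    if K: "K \<in> \<T>" for K
  proof -
    have "m \<sigma> * (vm \<sigma> K * r (nb \<sigma> K)) \<le> 0" if "\<sigma> \<in> E K" for \<sigma>
      using m0 vm0 r0[OF nbT[OF K that]] by (simp add: mult_nonneg_nonpos mult_nonpos_nonneg less_imp_le)
    from kinetic_energy_cell[OF vol[OF K] dt r0[OF K] this mass[OF K] mom[OF K] \<eta>[OF K] cfl[OF K]]
    show ?thesis
      by (simp add: z_def w distrib_left mult.assoc)
  qed
  have int: "vol K * (psi a \<gamma> (r K) - psi a \<gamma> (\<rho> n K))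
      \<le> - dt * (\<Sum>\<sigma>\<in>E K. m \<sigma> * (vp \<sigma> K * (psi_deriv a \<gamma> (r K) * r K)
            + vm \<sigma> K * (psi_deriv a \<gamma> (r K) * r (nb \<sigma> K))))"
    if K: "K \<in> \<T>" for K
  proof -
    \<comment> \<open>The tangent is taken at the new density, where the fluxes and the pressure are
      evaluated as well.\<close>
    have "psi a \<gamma> (r K) - psi a \<gamma> (\<rho> n K) \<le> psi_deriv a \<gamma> (r K) * (r K - \<rho> n K)"
      using psi_above_tangent[OF \<open>a > 0\<close> \<open>\<gamma> > 1\<close> r0[OF K] \<rho>0[OF K]] by (simp add: algebra_simps)
    then have "vol K * (psi a \<gamma> (r K) - psi a \<gamma> (\<rho> n K))
        \<le> vol K * (psi_deriv a \<gamma> (r K) * (r K - \<rho> n K))"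
      using vol[OF K] by (intro mult_left_mono) auto
    also have "\<dots> = psi_deriv a \<gamma> (r K) * (vol K * (r K - \<rho> n K))"
      by simp
    also have "\<dots> = - dt * (\<Sum>\<sigma>\<in>E K. m \<sigma> * (vp \<sigma> K * (psi_deriv a \<gamma> (r K) * r K)
            + vm \<sigma> K * (psi_deriv a \<gamma> (r K) * r (nb \<sigma> K))))"
      unfolding mass[OF K] by (simp add: sum_distrib_left algebra_simps)
    finally show ?thesis .
  qed

  \<comment> \<open>Pressure work against internal energy\<close>
  have "(\<Sum>K\<in>\<T>. vol K * (g K \<bullet> z K))
      = (\<Sum>K\<in>\<T>. vol K * (g K \<bullet> w K)) - (\<Sum>K\<in>\<T>. vol K * (g K \<bullet> u n K))"
    by (simp add: z_def inner_diff_right right_diff_distrib sum_subtractf)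
  also have "\<dots> = (\<Sum>K\<in>\<T>. \<Sum>\<sigma>\<in>E K. m \<sigma> * (q K * face_comp \<Omega> \<T> (u n) \<sigma> K))
      - (\<Sum>K\<in>\<T>. \<Sum>\<sigma>\<in>E K. m \<sigma> * (q K * face_comp \<Omega> \<T> w \<sigma> K))"
    unfolding g_def disc_grad_duality[OF tess] E_def m_def by simp
  \<comment> \<open>The signed parts add up to the face component of \<open>u n\<close> minus that
    of \<open>w\<close>, so the pressure work takes upwind form.\<close>
  also have "\<dots> = (\<Sum>K\<in>\<T>. \<Sum>\<sigma>\<in>E K. m \<sigma> * (vp \<sigma> K * q K + vm \<sigma> K * q K))"
    unfolding sum_subtractf[symmetric] vp_def vm_def distrib_right[symmetric] vel_pos_add_neg
    by (simp add: algebra_simps)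
  also have "\<dots> = (\<Sum>K\<in>\<T>. \<Sum>\<sigma>\<in>E K. m \<sigma> * vm \<sigma> K * (q K - q (nb \<sigma> K)))"
    by (rule flux)
  finally have work: "(\<Sum>K\<in>\<T>. vol K * (g K \<bullet> z K))
      = (\<Sum>K\<in>\<T>. \<Sum>\<sigma>\<in>E K. m \<sigma> * vm \<sigma> K * (q K - q (nb \<sigma> K)))" .
  have "(\<Sum>K\<in>\<T>. \<Sum>\<sigma>\<in>E K. m \<sigma> * vm \<sigma> K * (q K - q (nb \<sigma> K)))
      \<le> (\<Sum>K\<in>\<T>. \<Sum>\<sigma>\<in>E K. m \<sigma> * vm \<sigma> K *
          (psi_deriv a \<gamma> (r K) * r (nb \<sigma> K) - psi_deriv a \<gamma> (r (nb \<sigma> K)) * r (nb \<sigma> K)))"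
  proof (intro sum_mono mult_left_mono_neg)
    fix K \<sigma> assume K: "K \<in> \<T>" and \<sigma>: "\<sigma> \<in> E K"
    \<comment> \<open>By the Legendre relation the difference of the two sides is the gap between
      \<open>psi\<close> at the neighbour density and the tangent at \<open>r K\<close>. The
      nonpositive factor \<open>m \<sigma> * vm \<sigma> K\<close> reverses the inequality in the
      sum.\<close>
    show "psi_deriv a \<gamma> (r K) * r (nb \<sigma> K) - psi_deriv a \<gamma> (r (nb \<sigma> K)) * r (nb \<sigma> K) \<le> q K - q (nb \<sigma> K)"
      using psi_above_tangent[OF \<open>a > 0\<close> \<open>\<gamma> > 1\<close> r0[OF K] r0[OF nbT[OF K \<sigma>]]]
        pressure_eq_legendre[where a = a, OF \<open>\<gamma> > 1\<close> r0[OF K]]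
        pressure_eq_legendre[where a = a, OF \<open>\<gamma> > 1\<close> r0[OF nbT[OF K \<sigma>]]]
      by (simp add: q_def algebra_simps)
    show "m \<sigma> * vm \<sigma> K \<le> 0"
      using m0 vm0 by (simp add: mult_nonneg_nonpos)
  qed
  also have "\<dots> = (\<Sum>K\<in>\<T>. \<Sum>\<sigma>\<in>E K. m \<sigma> * (vp \<sigma> K * (psi_deriv a \<gamma> (r K) * r K)
            + vm \<sigma> K * (psi_deriv a \<gamma> (r K) * r (nb \<sigma> K))))"
    by (rule flux[symmetric])
  finally have dissipation: "(\<Sum>K\<in>\<T>. vol K * (g K \<bullet> z K))
      \<le> (\<Sum>K\<in>\<T>. \<Sum>\<sigma>\<in>E K. m \<sigma> * (vp \<sigma> K * (psi_deriv a \<gamma> (r K) * r K)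
            + vm \<sigma> K * (psi_deriv a \<gamma> (r K) * r (nb \<sigma> K))))"
    unfolding work .
  \<comment> \<open>Kinetic energy is transported conservatively: here \<open>Y K L = X L\<close> in
    \<open>flux\<close>.\<close>
  have transport: "(\<Sum>K\<in>\<T>. \<Sum>\<sigma>\<in>E K. m \<sigma> * (vp \<sigma> K * (r K * (norm (u n K))\<^sup>2)
            + vm \<sigma> K * (r (nb \<sigma> K) * (norm (u n (nb \<sigma> K)))\<^sup>2))) = 0"
    by (subst flux) simp
  have "(\<Sum>K\<in>\<T>. vol K * cell_energy a \<gamma> \<rho> u (Suc n) K) - (\<Sum>K\<in>\<T>. vol K * cell_energy a \<gamma> \<rho> u n K)
      = (\<Sum>K\<in>\<T>. vol K * (1/2 * r K * (norm (u (Suc n) K))\<^sup>2 - 1/2 * \<rho> n K * (norm (u n K))\<^sup>2))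
        + (\<Sum>K\<in>\<T>. vol K * (psi a \<gamma> (r K) - psi a \<gamma> (\<rho> n K)))"
    unfolding sum_subtractf[symmetric] sum.distrib[symmetric]
    by (simp add: cell_energy_def r_def algebra_simps)
  also have "\<dots> \<le> (\<Sum>K\<in>\<T>. dt * (vol K * (g K \<bullet> z K)
          - 1/2 * (\<Sum>\<sigma>\<in>E K. m \<sigma> * (vp \<sigma> K * (r K * (norm (u n K))\<^sup>2)
            + vm \<sigma> K * (r (nb \<sigma> K) * (norm (u n (nb \<sigma> K)))\<^sup>2)))))
      + (\<Sum>K\<in>\<T>. - dt * (\<Sum>\<sigma>\<in>E K. m \<sigma> * (vp \<sigma> K * (psi_deriv a \<gamma> (r K) * r K)
            + vm \<sigma> K * (psi_deriv a \<gamma> (r K) * r (nb \<sigma> K)))))"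
    by (intro add_mono sum_mono kin int)
  also have "\<dots> = dt * ((\<Sum>K\<in>\<T>. vol K * (g K \<bullet> z K))
      - (\<Sum>K\<in>\<T>. \<Sum>\<sigma>\<in>E K. m \<sigma> * (vp \<sigma> K * (psi_deriv a \<gamma> (r K) * r K)
            + vm \<sigma> K * (psi_deriv a \<gamma> (r K) * r (nb \<sigma> K)))))"
    unfolding sum_distrib_left[symmetric] sum_subtractf transport by (simp add: right_diff_distrib)
  also have "\<dots> \<le> 0"
    using dissipation dt by (simp add: mult_nonneg_nonpos)
  finally show ?thesis
    by simp
qed

end
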